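(* Let $L>0$ and $\sigma\ge 0$. There is a constant $\alpha_0>0$ depending only on $L$ such that the following holds. Let $f:\mathbb{R}^d\to[0,\infty)$ be $C^2$ with $|\nabla^2 f(w)|\le L$ for all $w\in\mathbb{R}^d$. Let $\{\alpha_m\}_{m\ge 1}$ be a deterministic nonincreasing sequence with $0\le\alpha_m\le\alpha_0$ for all $m$, $\sum_m\alpha_m=\infty$ and $\sum_m\alpha_m^2<\infty$. Let $\{w_m\}_{m\ge1}$ be a sequence of $\mathbb{R}^d$-valued random variables generated by stochastic gradient descent for $f$ with step sizes $\alpha_m$, with variance bound $\sigma^2$ (as defined in the context), and with $E[f(w_1)]<\infty$. Then: (i) $E[f(w_m)]\to\liminf_{k\to\infty}E[f(w_k)]$ as $m\to\infty$ (i.e. $E[f(w_m)]$ converges); (ii) $E[|\nabla f(w_m)|^2]\to 0$ as $m\to\infty$. (iii) If, in addition, $|f(w)|\to\infty$ as $|w|\to\infty$, then $w_m$ converges in probability to the set $\mathcal{C}:=\{w:\nabla f(w)=0\}$ of critical points of $f$, i.e. for every $\delta>0$, $P(\mathrm{dist}(w_m,\mathcal{C})>\delta)\to0$ as $m\to\infty$.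
   Context: Stochastic gradient descent (SGD): at each step $m\ge1$ there is a random vector $\tilde\nabla f(w_m)\in\mathbb{R}^d$ (the stochastic gradient estimator evaluated at $w_m$), on the same probability space as $w_m$, with $E[\tilde\nabla f(w_m)\mid w_m]=\nabla f(w_m)$, and $$w_{m+1}=w_m-\alpha_m\tilde\nabla f(w_m).$$ The variance bound $\sigma^2$ means: $E\big[|\tilde\nabla f(w_m)|^2-|\nabla f(w_m)|^2\big]\le\sigma^2$ for all $m$. Here $|\cdot|$ is the Euclidean norm on vectors and the operator norm on matrices, and $\mathrm{dist}(w,\mathcal{C})=\inf_{c\in\mathcal{C}}|w-c|$. *)

theory Defs
  imports "HOL-Probability.Probability"
begin

definition grad :: "(real ^ 'n \<Rightarrow> real) \<Rightarrow> real ^ 'n \<Rightarrow> real ^ 'n" where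
  "grad f x = (THE D. GDERIV f x :> D)"

definition hessian :: "(real ^ 'n \<Rightarrow> real) \<Rightarrow> real ^ 'n \<Rightarrow> real ^ 'n ^ 'n" where
  "hessian f x = matrix (frechet_derivative (grad f) (at x))"

definition C2 :: "(real ^ 'n \<Rightarrow> real) \<Rightarrow> bool" where
  "C2 f \<longleftrightarrow> (\<forall>x. f differentiable (at x)) \<and> (\<forall>x. grad f differentiable (at x)) \<and>
     continuous_on UNIV (hessian f)"

definition matrix_opnorm :: "real ^ 'n ^ 'm \<Rightarrow> real" where
  "matrix_opnorm A = onorm (\<lambda>v. A *v v)"

(* \<open>E[X | W] = Y\<close> for integrable vector-valued \<open>X\<close>, where conditioning on the random vector \<open>W\<close>
   means conditioning on the sigma-algebra generated by \<open>W\<close>.  The library only has conditional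
   expectations of scalars, so the equation is imposed in each coordinate. *)
definition has_cond_exp_given ::
    "'a measure \<Rightarrow> ('a \<Rightarrow> real ^ 'n) \<Rightarrow> ('a \<Rightarrow> real ^ 'k) \<Rightarrow> ('a \<Rightarrow> real ^ 'n) \<Rightarrow> bool" where
  "has_cond_exp_given M X W Y \<longleftrightarrow> integrable M X \<and>
     (\<forall>i. AE x in M. real_cond_exp M (vimage_algebra (space M) W borel) (\<lambda>x. X x $ i) x = Y x $ i)"

(* \<open>g m\<close> is the stochastic gradient estimator at \<open>w m\<close>.  Sequences are indexed by \<open>m \<ge> 1\<close>; the
   values at index 0 are unconstrained.  Equality of random variables is almost sure. *)
definition sgd :: "'a measure \<Rightarrow> (real ^ 'n \<Rightarrow> real) \<Rightarrow> (nat \<Rightarrow> real) \<Rightarrow>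
    (nat \<Rightarrow> 'a \<Rightarrow> real ^ 'n) \<Rightarrow> (nat \<Rightarrow> 'a \<Rightarrow> real ^ 'n) \<Rightarrow> bool" where
  "sgd M f \<alpha> w g \<longleftrightarrow>
     (\<forall>m\<ge>1. w m \<in> borel_measurable M \<and> g m \<in> borel_measurable M \<and>
        has_cond_exp_given M (g m) (w m) (\<lambda>x. grad f (w m x)) \<and>
        (AE x in M. w (Suc m) x = w m x - \<alpha> m *\<^sub>R g m x))"

(* Integrability is required because a Bochner integral that does not exist equals 0. *)
definition sgd_variance_bound :: "'a measure \<Rightarrow> (real ^ 'n \<Rightarrow> real) \<Rightarrow>
    (nat \<Rightarrow> 'a \<Rightarrow> real ^ 'n) \<Rightarrow> (nat \<Rightarrow> 'a \<Rightarrow> real ^ 'n) \<Rightarrow> real \<Rightarrow> bool" where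
  "sgd_variance_bound M f w g \<sigma> \<longleftrightarrow>
     (\<forall>m\<ge>1. integrable M (\<lambda>x. (norm (g m x))\<^sup>2 - (norm (grad f (w m x)))\<^sup>2) \<and>
        (\<integral>x. (norm (g m x))\<^sup>2 - (norm (grad f (w m x)))\<^sup>2 \<partial>M) \<le> \<sigma>\<^sup>2)"

(* \<open>infdist\<close> to the empty set is 0, but a nonnegative coercive \<open>C2\<close> function attains its minimum, so
   this set is nonempty wherever the distance to it is used. *)
definition critical_points :: "(real ^ 'n \<Rightarrow> real) \<Rightarrow> (real ^ 'n) set" where
  "critical_points f = {w. grad f w = 0}"

(* The bound on the step sizes, depending on \<open>L\<close> only.  It is a closed term rather than an
   existentially quantified variable: the dimension \<open>CARD('n)\<close> and the sample space \<open>'a\<close> are types,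
   so an existential inside a theorem could depend on them. *)
definition sgd_alpha0 :: "real \<Rightarrow> real" where
  "sgd_alpha0 L = 1 / L"

(* Expectations of nonnegative quantities are nonnegative Lebesgue integrals with values in
   \<open>[0, \<infinity>]\<close>, so that no integrability is presupposed. *)
definition expect_nn :: "'a measure \<Rightarrow> ('a \<Rightarrow> real) \<Rightarrow> ennreal" where
  "expect_nn M X = (\<integral>\<^sup>+ x. ennreal (X x) \<partial>M)"

end

(* Lipschitz continuity of the gradient gives the descent inequality
     E f(w') + (a / 2) E |grad f(w)|^2 <= E f(w) + C a^2
   for one step of size a <= 1 / L.  As the squares of the step sizes are summable, E f(w_m) converges
   and the series of a_m E |grad f(w_m)|^2 converges.  One step increases E |grad f|^2 by at most K a,
   which, together with the divergence of the series of the a_m, forces E |grad f(w_m)|^2 to 0.  For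
   coercive f, Markov's inequality confines w_m to a compact sublevel set up to small probability, and
   there |grad f| is bounded away from 0 at distance at least delta from the critical points. *)
theory Submission
  imports Defs
begin

section \<open>Real sequences: perturbed monotonicity and weighted series\<close>

text \<open>Subtracting the partial sums of \<open>e\<close> from \<open>a\<close> gives a
  decreasing sequence, bounded below because those sums converge and \<open>a\<close> is
  nonnegative. Then \<open>b\<close> is dominated by the telescoping differences of \<open>a\<close>
  plus \<open>e\<close>. Later \<open>a\<close> is the expected value of \<open>f\<close> and
  \<open>b\<close> the weighted squared gradient.\<close>

lemma almost_decreasing_convergent:
  fixes a b e :: "nat \<Rightarrow> real"
  assumes a: "\<And>n. a n \<ge> 0" and b: "\<And>n. b n \<ge> 0" and e: "summable e"
    and step: "\<And>n. a (Suc n) + b n \<le> a n + e n"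
  shows "convergent a" and "summable b"
proof -
  define c where "c n = a n - (\<Sum>k<n. e k)" for n
  have lim_e: "(\<lambda>n. \<Sum>k<n. e k) \<longlonglongrightarrow> suminf e"
    using e by (rule summable_LIMSEQ)
  then obtain B where B: "\<And>n. norm (\<Sum>k<n. e k) \<le> B"
    using convergent_imp_Bseq[of "\<lambda>n. \<Sum>k<n. e k"] by (auto simp: convergent_def Bseq_def)
  have "decseq c"
    unfolding decseq_Suc_iff c_def
  proof
    fix n
    show "a (Suc n) - (\<Sum>k<Suc n. e k) \<le> a n - (\<Sum>k<n. e k)"
      using step[of n] b[of n] by simp
  qed
  moreover have "\<forall>n. - B \<le> c n"
  proof
    show "- B \<le> c n" for n
      using B[of n] a[of n] by (simp add: c_def)
  qed
  ultimately obtain l where "c \<longlonglongrightarrow> l"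
    by (rule decseq_convergent)
  then have "(\<lambda>n. c n + (\<Sum>k<n. e k)) \<longlonglongrightarrow> l + suminf e"
    by (intro tendsto_add lim_e)
  then have lim_a: "a \<longlonglongrightarrow> l + suminf e"
    by (simp add: c_def)
  then show "convergent a"
    by (auto simp: convergent_def)
  have "summable (\<lambda>n. (a n - a (Suc n)) + e n)"
    using telescope_summable'[OF lim_a] e by (rule summable_add)
  then show "summable b"
  proof (rule summable_comparison_test'[where N = 0])
    show "norm (b n) \<le> (a n - a (Suc n)) + e n" for n
      using step[of n] b[of n] by simp
  qed
qed

text \<open>Divergence of the weights forces \<open>G\<close> below any given level at arbitrarily
  late indices. The growth bound keeps it from climbing back: a climb above the level uses up weight
  in a region where \<open>a n * G n\<close> is comparable to \<open>a n\<close>, and late blocks of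
  that series are small.\<close>

lemma weighted_summable_imp_tendsto_zero:
  fixes G a :: "nat \<Rightarrow> real"
  assumes G: "\<And>n. G n \<ge> 0" and a: "\<And>n. a n \<ge> 0" and lim_a: "a \<longlonglongrightarrow> 0"
    and div: "\<not> summable a" and sum: "summable (\<lambda>n. a n * G n)"
    and K: "K \<ge> 0" and incr: "\<And>n. G (Suc n) \<le> G n + K * a n"
  shows "G \<longlonglongrightarrow> 0"
proof (rule LIMSEQ_I)
  fix r :: real
  assume "r > 0"
  \<comment> \<open>The final estimate has three terms, \<open>\<epsilon>\<close>,
    \<open>K * \<eta>\<close> and \<open>K / \<epsilon> * \<zeta>\<close>, each at most
    \<open>r / 4\<close>, so their sum stays strictly below \<open>r\<close>. The denominators
    \<open>K + 1\<close> cover the case \<open>K = 0\<close>.\<close>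
  define \<epsilon> where "\<epsilon> = r / 4"
  have \<epsilon>: "\<epsilon> > 0"
    using \<open>r > 0\<close> by (simp add: \<epsilon>_def)
  define \<eta> where "\<eta> = \<epsilon> / (K + 1)"
  have \<eta>: "\<eta> > 0" "K * \<eta> \<le> \<epsilon>"
    using \<epsilon> K by (auto simp: \<eta>_def field_simps)
  define \<zeta> where "\<zeta> = \<epsilon> * \<epsilon> / (K + 1)"
  have \<zeta>: "\<zeta> > 0" "K / \<epsilon> * \<zeta> \<le> \<epsilon>"
    using \<epsilon> K by (auto simp: \<zeta>_def field_simps)
  obtain N1 where N1: "\<And>n. n \<ge> N1 \<Longrightarrow> a n < \<eta>"
    using LIMSEQ_D[OF lim_a \<eta>(1)] a by fastforce
  obtain N2 where N2: "\<And>m n. m \<ge> N2 \<Longrightarrow> norm (\<Sum>k=m..<n. a k * G k) < \<zeta>"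
    using sum \<zeta>(1) unfolding summable_Cauchy by blast
  define N where "N = max N1 N2"
  \<comment> \<open>If \<open>G\<close> stayed at or above \<open>\<epsilon>\<close> from
    \<open>N\<close> on, \<open>a n\<close> would be at most \<open>a n * G n / \<epsilon>\<close>
    there, hence summable.\<close>
  obtain k where k: "k \<ge> N" "G k < \<epsilon>"
  proof (rule ccontr)
    assume "\<not> thesis"
    then have ge: "G k \<ge> \<epsilon>" if "k \<ge> N" for k
      using that \<open>\<And>k. k \<ge> N \<Longrightarrow> G k < \<epsilon> \<Longrightarrow> thesis\<close> by fastforce
    have "summable (\<lambda>n. 1 / \<epsilon> * (a n * G n))"
      using sum by (rule summable_mult)
    then have "summable a"
    proof (rule summable_comparison_test'[where N = N])
      fix n assume "n \<ge> N"
      then have "a n * \<epsilon> \<le> a n * G n"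
        using a[of n] ge by (simp add: mult_left_mono)
      then show "norm (a n) \<le> 1 / \<epsilon> * (a n * G n)"
        using \<epsilon> a[of n] by (simp add: field_simps)
    qed
    with div show False ..
  qed
  \<comment> \<open>Wherever \<open>G\<close> exceeds \<open>\<epsilon>\<close>, its increment \<open>K * a n\<close> is at most \<open>K / \<epsilon> * (a n * G n)\<close>, which is
    paid for by the convergent series; below \<open>\<epsilon>\<close> a single step cannot overshoot by more than \<open>K * \<eta>\<close>.\<close>
  have bound: "G n \<le> \<epsilon> + K * \<eta> + K / \<epsilon> * (\<Sum>j=k..<n. a j * G j)" if "n \<ge> k" for n
    using that
  proof (induction n rule: dec_induct)
    case base
    then show ?case using k K \<eta> by (simp add: add_increasing2 less_imp_le)
  next
    case (step n)
    have nonneg: "0 \<le> K / \<epsilon> * (\<Sum>j=k..<m. a j * G j)" for m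
      using K \<epsilon> G a by (intro mult_nonneg_nonneg sum_nonneg) auto
    show ?case
    proof (cases "G n \<ge> \<epsilon>")
      case True
      have "K * a n * \<epsilon> \<le> K * a n * G n"
        using True K a[of n] by (intro mult_left_mono) auto
      then have "K * a n \<le> K / \<epsilon> * (a n * G n)"
        using \<epsilon> by (simp add: field_simps)
      then show ?thesis
        using incr[of n] step by (simp add: distrib_left)
    next
      case False
      have "K * a n \<le> K * \<eta>"
        using N1[of n] step k K by (intro mult_left_mono) (auto simp: N_def)
      then show ?thesis
        using incr[of n] False nonneg[of "Suc n"] by linarith
    qed
  qed
  show "\<exists>n0. \<forall>n\<ge>n0. norm (G n - 0) < r"
  proof (intro exI allI impI)
    fix n assume "n \<ge> k"
    have "(\<Sum>j=k..<n. a j * G j) \<le> \<zeta>"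
      using N2[of k n] k by (auto simp: N_def)
    then have "K / \<epsilon> * (\<Sum>j=k..<n. a j * G j) \<le> K / \<epsilon> * \<zeta>"
      using K \<epsilon> by (intro mult_left_mono) auto
    then show "norm (G n - 0) < r"
      using bound[OF \<open>n \<ge> k\<close>] \<eta> \<zeta> \<open>r > 0\<close> G[of n] by (simp add: \<epsilon>_def)
  qed
qed

section \<open>Nonnegative functions with Lipschitz gradient\<close>

locale lipschitz_gradient =
  fixes f :: "'a::real_inner \<Rightarrow> real" and F :: "'a \<Rightarrow> 'a" and L :: real
  assumes L_pos: "L > 0"
    and gderiv: "\<And>x. GDERIV f x :> F x"
    and lipschitz: "\<And>x y. norm (F x - F y) \<le> L * norm (x - y)"
    and nonneg: "\<And>x. f x \<ge> 0"
begin

text \<open>The first-order Taylor bound with quadratic remainder, obtained by monotonicity along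
  the segment from \<open>x\<close> to \<open>x + h\<close>, which uses only first derivatives of
  \<open>f\<close>.\<close>

lemma descent: "f (x + h) \<le> f x + h \<bullet> F x + L / 2 * (norm h)\<^sup>2"
proof -
  \<comment> \<open>\<open>\<phi>\<close> is \<open>f\<close> on the segment minus the linear and
    quadratic terms of the bound, so the claim is \<open>\<phi> 1 \<le> \<phi> 0\<close>.
    Cauchy-Schwarz and the Lipschitz bound make its derivative nonpositive.\<close>
  define \<phi> where "\<phi> t = f (x + t *\<^sub>R h) - t * (h \<bullet> F x) - L / 2 * t\<^sup>2 * (norm h)\<^sup>2" for t :: real
  have D: "(\<phi> has_real_derivative
      h \<bullet> F (x + t *\<^sub>R h) - h \<bullet> F x - L * t * (norm h)\<^sup>2) (at t)" for t
  proof -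
    have line: "((\<lambda>t. x + t *\<^sub>R h) has_derivative (\<lambda>s. s *\<^sub>R h)) (at t)"
      by (auto intro!: derivative_eq_intros)
    have "((\<lambda>t. f (x + t *\<^sub>R h)) has_derivative (\<lambda>s. (s *\<^sub>R h) \<bullet> F (x + t *\<^sub>R h))) (at t)"
      using has_derivative_compose[OF line gderiv[of "x + t *\<^sub>R h", unfolded gderiv_def]] .
    then have "((\<lambda>t. f (x + t *\<^sub>R h)) has_real_derivative h \<bullet> F (x + t *\<^sub>R h)) (at t)"
      by (simp add: has_field_derivative_def mult_commute_abs)
    then show ?thesis
      unfolding \<phi>_def by (auto intro!: derivative_eq_intros)
  qed
  have "\<phi> 1 \<le> \<phi> 0"
  proof (rule DERIV_nonpos_imp_nonincreasing[of 0 1 \<phi>])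
    fix t :: real assume t: "0 \<le> t" "t \<le> 1"
    have "h \<bullet> (F (x + t *\<^sub>R h) - F x) \<le> norm h * norm (F (x + t *\<^sub>R h) - F x)"
      by (rule norm_cauchy_schwarz)
    also have "\<dots> \<le> norm h * (L * norm (t *\<^sub>R h))"
      using lipschitz[of "x + t *\<^sub>R h" x] by (intro mult_left_mono) auto
    also have "\<dots> = L * t * (norm h)\<^sup>2"
      using t by (simp add: power2_eq_square)
    finally show "\<exists>y. (\<phi> has_real_derivative y) (at t) \<and> y \<le> 0"
      using D[of t] by (auto simp: inner_diff_right)
  qed simp
  then show ?thesis
    by (simp add: \<phi>_def)
qed

text \<open>The step \<open>- F x / L\<close> minimizes the quadratic upper bound of
  \<open>descent\<close>; the minimal value \<open>f x - (norm (F x))\<^sup>2 / (2 * L)\<close>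
  cannot be negative because \<open>f\<close> is not. This lets the expectation of \<open>f\<close>
  control the second moment of the gradient.\<close>

lemma gradient_norm_sq_le: "(norm (F x))\<^sup>2 \<le> 2 * L * f x"
proof -
  have "0 \<le> f (x + (- 1 / L) *\<^sub>R F x)"
    by (rule nonneg)
  also have "\<dots> \<le> f x + ((- 1 / L) *\<^sub>R F x) \<bullet> F x + L / 2 * (norm ((- 1 / L) *\<^sub>R F x))\<^sup>2"
    by (rule descent)
  also have "\<dots> = f x - (norm (F x))\<^sup>2 / (2 * L)"
    using L_pos
    by (simp add: power2_norm_eq_inner[symmetric] power_mult_distrib power2_eq_square field_simps)
  finally show ?thesis
    using L_pos by (simp add: field_simps)
qed

text \<open>Expanding the square after the triangle inequality leaves a cross term and a term
  quadratic in \<open>a\<close>. The restriction on \<open>a\<close> absorbs the latter, so the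
  growth is linear in \<open>a\<close>.\<close>

lemma gradient_step_norm_sq_le:
  assumes "0 \<le> a" "a \<le> 1 / L"
  shows "(norm (F (x - a *\<^sub>R g)))\<^sup>2 \<le> (norm (F x))\<^sup>2 + L * a * ((norm (F x))\<^sup>2 + 2 * (norm g)\<^sup>2)"
proof -
  have La: "0 \<le> L * a" "L * a \<le> 1"
    using assms L_pos by (auto simp: field_simps)
  have "norm (F (x - a *\<^sub>R g)) \<le> norm (F x) + norm (F (x - a *\<^sub>R g) - F x)"
    by (metis add.commute diff_add_cancel norm_triangle_ineq)
  also have "\<dots> \<le> norm (F x) + L * a * norm g"
    using lipschitz[of "x - a *\<^sub>R g" x] assms by simp
  finally have "(norm (F (x - a *\<^sub>R g)))\<^sup>2 \<le> (norm (F x) + L * a * norm g)\<^sup>2"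
    by (intro power_mono) auto
  also have "\<dots> = (norm (F x))\<^sup>2 + L * a * (2 * norm (F x) * norm g + L * a * (norm g)\<^sup>2)"
    by (simp add: power2_eq_square algebra_simps)
  \<comment> \<open>The cross term is split by the inequality between arithmetic and geometric
    means; the explicit factor \<open>1\<close> is what replaces \<open>L * a\<close> under
    monotonicity of multiplication.\<close>
  also have "\<dots> \<le> (norm (F x))\<^sup>2 + L * a * ((norm (F x))\<^sup>2 + (norm g)\<^sup>2 + 1 * (norm g)\<^sup>2)"
    using La sum_squares_bound[of "norm (F x)" "norm g"]
    by (intro add_left_mono mult_left_mono add_mono mult_right_mono) auto
  finally show ?thesis
    by (simp add: add.commute)
qed

lemma continuous_on_f: "continuous_on S f"
  using gderiv unfolding gderiv_def
  by (meson has_derivative_continuous continuous_at_imp_continuous_on)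

lemma continuous_on_F: "continuous_on S F"
proof -
  have "L-lipschitz_on S F"
    using L_pos lipschitz by (intro lipschitz_onI) (auto simp: dist_norm)
  then show ?thesis
    by (rule lipschitz_on_continuous_on)
qed

lemma integrable_gradient_norm_sq:
  assumes [measurable]: "X \<in> borel_measurable M" and "integrable M (\<lambda>x. f (X x))"
  shows "integrable M (\<lambda>x. (norm (F (X x)))\<^sup>2)"
proof (rule Bochner_Integration.integrable_bound)
  have [measurable]: "F \<in> borel_measurable borel"
    using continuous_on_F by (rule borel_measurable_continuous_onI)
  show "(\<lambda>x. (norm (F (X x)))\<^sup>2) \<in> borel_measurable M"
    by measurable
  show "integrable M (\<lambda>x. 2 * L * f (X x))"
    using assms by simp
  show "AE x in M. norm ((norm (F (X x)))\<^sup>2) \<le> norm (2 * L * f (X x))"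
    using gradient_norm_sq_le nonneg L_pos by simp
qed

end

section \<open>From a bounded Hessian to a Lipschitz gradient\<close>

text \<open>\<open>grad\<close> is a definite description, so existence and uniqueness are both
  proved: the derivative is represented by its values on the standard basis, and a vector is
  determined by its inner products.\<close>

lemma C2_gderiv:
  assumes "C2 f"
  shows "GDERIV f x :> grad f x"
proof -
  obtain f' where f': "(f has_derivative f') (at x)"
    using assms by (auto simp: C2_def differentiable_def)
  interpret bounded_linear f'
    using f' by (rule has_derivative_bounded_linear)
  have "f' = (\<lambda>h. h \<bullet> (\<Sum>i\<in>Basis. f' i *\<^sub>R i))"
  proof
    fix h
    have "f' h = f' (\<Sum>i\<in>Basis. (h \<bullet> i) *\<^sub>R i)"
      by (simp add: euclidean_representation)
    then show "f' h = h \<bullet> (\<Sum>i\<in>Basis. f' i *\<^sub>R i)"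
      by (simp add: sum scaleR inner_sum_right mult.commute)
  qed
  with f' have D: "GDERIV f x :> (\<Sum>i\<in>Basis. f' i *\<^sub>R i)"
    by (simp add: gderiv_def)
  have unique: "D' = D''" if "GDERIV f x :> D'" "GDERIV f x :> D''" for D' D''
  proof -
    have "(\<lambda>h. h \<bullet> D') = (\<lambda>h. h \<bullet> D'')"
      using that has_derivative_unique unfolding gderiv_def by blast
    then show ?thesis
      by (metis vector_eq_ldot)
  qed
  show ?thesis
    unfolding grad_def by (rule theI[of "\<lambda>D. GDERIV f x :> D", OF D]) (rule unique[OF _ D])
qed

lemma C2_grad_lipschitz:
  fixes f :: "real ^ 'n \<Rightarrow> real"
  assumes "C2 f" and L: "\<And>v. matrix_opnorm (hessian f v) \<le> L"
  shows "norm (grad f x - grad f y) \<le> L * norm (x - y)"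
proof (rule differentiable_bound[of UNIV])
  fix v :: "real ^ 'n"
  have d: "(grad f has_derivative frechet_derivative (grad f) (at v)) (at v)"
    using assms by (simp add: C2_def frechet_derivative_works[symmetric])
  then show "(grad f has_derivative frechet_derivative (grad f) (at v)) (at v within UNIV)"
    by simp
  \<comment> \<open>The derivative of \<open>grad f\<close> is linear, so multiplying by its matrix
    recovers it and \<open>matrix_opnorm\<close> becomes the \<open>onorm\<close> required by the
    mean value inequality.\<close>
  have "(\<lambda>u. hessian f v *v u) = frechet_derivative (grad f) (at v)"
    unfolding hessian_def
    using has_derivative_linear[OF d] by (rule matrix_vector_mul(2))
  then show "onorm (frechet_derivative (grad f) (at v)) \<le> L"
    using L[of v] by (simp add: matrix_opnorm_def)
qed auto

section \<open>One step of stochastic gradient descent in expectation\<close>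

text \<open>\<open>F (W x)\<close> is a function of \<open>W\<close>, so it can be pulled out of the
  conditional expectation given \<open>W\<close>, which turns \<open>G\<close> into
  \<open>F (W x)\<close>. The argument runs coordinate by coordinate; square integrability makes
  each product integrable.\<close>

lemma cond_exp_given_inner:
  fixes G :: "'a \<Rightarrow> real ^ 'n" and W :: "'a \<Rightarrow> real ^ 'k"
  assumes "prob_space M" and W [measurable]: "W \<in> borel_measurable M"
    and cond: "has_cond_exp_given M G W (\<lambda>x. F (W x))"
    and F [measurable]: "F \<in> borel_measurable borel"
    and sq_F: "integrable M (\<lambda>x. (norm (F (W x)))\<^sup>2)" and sq_G: "integrable M (\<lambda>x. (norm (G x))\<^sup>2)"
  shows "integrable M (\<lambda>x. F (W x) \<bullet> G x)"
    and "(\<integral>x. F (W x) \<bullet> G x \<partial>M) = (\<integral>x. (norm (F (W x)))\<^sup>2 \<partial>M)"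
proof -
  interpret prob_space M by fact
  let ?A = "vimage_algebra (space M) W borel"
  have [measurable]: "G \<in> borel_measurable M"
    using cond by (auto simp: has_cond_exp_given_def)
  have "subalgebra M ?A"
    using W by (auto simp: subalgebra_def sets_vimage_algebra2 measurable_def)
  then interpret finite_measure_subalgebra M ?A
    by unfold_locales
  have [measurable]: "(\<lambda>v :: real ^ 'n. v $ i) \<in> borel_measurable borel" for i
    by (intro borel_measurable_continuous_onI continuous_intros)
  have int_mult: "integrable M (\<lambda>x. X x $ i * Y x $ i)"
    if "integrable M (\<lambda>x. (norm (X x))\<^sup>2)" "integrable M (\<lambda>x. (norm (Y x))\<^sup>2)"
      and [measurable]: "X \<in> borel_measurable M" "Y \<in> borel_measurable M"
    for X Y :: "'a \<Rightarrow> real ^ 'n" and i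
  proof (rule Bochner_Integration.integrable_bound)
    show "integrable M (\<lambda>x. (norm (X x))\<^sup>2 + (norm (Y x))\<^sup>2)"
      using that by simp
    have "\<bar>a $ i * b $ i\<bar> \<le> (norm a)\<^sup>2 + (norm b)\<^sup>2" for a b :: "real ^ 'n"
    proof -
      have "\<bar>a $ i * b $ i\<bar> \<le> norm a * norm b"
        unfolding abs_mult by (intro mult_mono component_le_norm_cart) auto
      also have "\<dots> \<le> (norm a)\<^sup>2 + (norm b)\<^sup>2"
        using sum_squares_bound[of "norm a" "norm b"] mult_nonneg_nonneg[OF norm_ge_zero norm_ge_zero, of a b]
        by linarith
      finally show ?thesis .
    qed
    then show "AE x in M. norm (X x $ i * Y x $ i) \<le> norm ((norm (X x))\<^sup>2 + (norm (Y x))\<^sup>2)"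
      by simp
  qed measurable
  have FG: "integrable M (\<lambda>x. F (W x) $ i * G x $ i)" for i
    by (intro int_mult sq_F sq_G) measurable
  have FF: "integrable M (\<lambda>x. F (W x) $ i * F (W x) $ i)" for i
    by (intro int_mult sq_F) measurable
  have eq: "(\<integral>x. F (W x) $ i * G x $ i \<partial>M) = (\<integral>x. F (W x) $ i * F (W x) $ i \<partial>M)" for i
  proof -
    \<comment> \<open>Measurability with respect to the generated sigma-algebra, rather than
      \<open>M\<close>, is what permits pulling out \<open>F (W x) $ i\<close>.\<close>
    have [measurable]: "W \<in> borel_measurable ?A"
      by (rule measurable_vimage_algebra1) simp
    have "(\<integral>x. F (W x) $ i * G x $ i \<partial>M) = (\<integral>x. F (W x) $ i * real_cond_exp M ?A (\<lambda>x. G x $ i) x \<partial>M)"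
      by (rule real_cond_exp_intg(2)[symmetric]) (use FG in measurable)
    also have "\<dots> = (\<integral>x. F (W x) $ i * F (W x) $ i \<partial>M)"
      using cond by (intro integral_cong_AE) (auto simp: has_cond_exp_given_def)
    finally show ?thesis .
  qed
  show "integrable M (\<lambda>x. F (W x) \<bullet> G x)"
    using FG by (simp add: inner_vec_def)
  show "(\<integral>x. F (W x) \<bullet> G x \<partial>M) = (\<integral>x. (norm (F (W x)))\<^sup>2 \<partial>M)"
    using FG FF eq by (simp add: power2_norm_eq_inner inner_vec_def)
qed

text \<open>Integrates the pathwise bounds \<open>descent\<close> and
  \<open>gradient_step_norm_sq_le\<close>. Unbiasedness evaluates the inner product, and the
  variance bound trades the second moment of \<open>G\<close> for that of \<open>F (W x)\<close>
  plus \<open>V\<close>.\<close>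

lemma sgd_expectation_step:
  fixes f :: "real ^ 'n \<Rightarrow> real" and W W' G :: "'a \<Rightarrow> real ^ 'n"
  assumes "lipschitz_gradient f F L" "prob_space M"
    and W [measurable]: "W \<in> borel_measurable M" and W' [measurable]: "W' \<in> borel_measurable M"
    and cond: "has_cond_exp_given M G W (\<lambda>x. F (W x))"
    and var_int: "integrable M (\<lambda>x. (norm (G x))\<^sup>2 - (norm (F (W x)))\<^sup>2)"
    and var: "(\<integral>x. (norm (G x))\<^sup>2 - (norm (F (W x)))\<^sup>2 \<partial>M) \<le> V"
    and a: "0 \<le> a" "a \<le> 1 / L"
    and upd: "AE x in M. W' x = W x - a *\<^sub>R G x"
    and int_f: "integrable M (\<lambda>x. f (W x))"
  shows "integrable M (\<lambda>x. f (W' x))"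
    and "(\<integral>x. f (W' x) \<partial>M) + a / 2 * (\<integral>x. (norm (F (W x)))\<^sup>2 \<partial>M) \<le> (\<integral>x. f (W x) \<partial>M) + L * V / 2 * a\<^sup>2"
    and "(\<integral>x. (norm (F (W' x)))\<^sup>2 \<partial>M)
      \<le> (\<integral>x. (norm (F (W x)))\<^sup>2 \<partial>M) + L * a * (3 * (\<integral>x. (norm (F (W x)))\<^sup>2 \<partial>M) + 2 * V)"
proof -
  interpret prob_space M by fact
  interpret lipschitz_gradient f F L by fact
  have [measurable]: "f \<in> borel_measurable borel" "F \<in> borel_measurable borel"
    using continuous_on_f continuous_on_F by (auto intro: borel_measurable_continuous_onI)
  have [measurable]: "G \<in> borel_measurable M"
    using cond by (auto simp: has_cond_exp_given_def)
  note sq_F = integrable_gradient_norm_sq[OF W int_f]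
  \<comment> \<open>The variance hypothesis concerns only a difference; adding back the integrable
    squared gradient gives a finite second moment of \<open>G\<close>.\<close>
  have sq_G: "integrable M (\<lambda>x. (norm (G x))\<^sup>2)"
    using Bochner_Integration.integrable_add[OF var_int sq_F] by simp
  note inner = cond_exp_given_inner[OF \<open>prob_space M\<close> W cond _ sq_F sq_G, simplified]
  define EF where "EF = (\<integral>x. (norm (F (W x)))\<^sup>2 \<partial>M)"
  define EG where "EG = (\<integral>x. (norm (G x))\<^sup>2 \<partial>M)"
  have EG: "EG \<le> EF + V"
    using var sq_F sq_G by (simp add: EF_def EG_def)
  have int_bound: "integrable M (\<lambda>x. f (W x) - a * (F (W x) \<bullet> G x) + L / 2 * a\<^sup>2 * (norm (G x))\<^sup>2)"
    using int_f inner(1) sq_G by simp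
  have AE_f: "AE x in M. f (W' x) \<le> f (W x) - a * (F (W x) \<bullet> G x) + L / 2 * a\<^sup>2 * (norm (G x))\<^sup>2"
    using upd
  proof eventually_elim
    case (elim x)
    then show ?case
      using descent[of "W x" "- (a *\<^sub>R G x)"]
      by (simp add: power_mult_distrib inner_commute mult.assoc)
  qed
  \<comment> \<open>As \<open>f\<close> is nonnegative, the pathwise upper bound also dominates in
    absolute value.\<close>
  show int_f': "integrable M (\<lambda>x. f (W' x))"
  proof (rule Bochner_Integration.integrable_bound[OF int_bound])
    show "AE x in M. norm (f (W' x))
        \<le> norm (f (W x) - a * (F (W x) \<bullet> G x) + L / 2 * a\<^sup>2 * (norm (G x))\<^sup>2)"
      using AE_f
    proof eventually_elim
      case (elim x)
      then show ?case
        using nonneg[of "W' x"] by simp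
    qed
  qed measurable
  have "(\<integral>x. f (W' x) \<partial>M)
      \<le> (\<integral>x. f (W x) - a * (F (W x) \<bullet> G x) + L / 2 * a\<^sup>2 * (norm (G x))\<^sup>2 \<partial>M)"
    by (rule integral_mono_AE[OF int_f' int_bound AE_f])
  also have "\<dots> = (\<integral>x. f (W x) \<partial>M) - a * EF + L / 2 * a\<^sup>2 * EG"
    using int_f inner sq_G by (simp add: EF_def EG_def)
  also have "\<dots> \<le> (\<integral>x. f (W x) \<partial>M) - a * EF + L / 2 * a\<^sup>2 * (EF + V)"
    using EG L_pos by (intro add_left_mono mult_left_mono) auto
  \<comment> \<open>The factor \<open>a * L\<close>, at most 1, is isolated so that the second-order
    term consumes at most half of the decrease \<open>a * EF\<close>.\<close>
  also have "\<dots> = (\<integral>x. f (W x) \<partial>M) - a * EF + (a * L) * (a / 2 * EF) + L * V / 2 * a\<^sup>2"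
    by (simp add: power2_eq_square algebra_simps)
  also have "\<dots> \<le> (\<integral>x. f (W x) \<partial>M) - a * EF + 1 * (a / 2 * EF) + L * V / 2 * a\<^sup>2"
    using a L_pos
    by (intro add_left_mono add_right_mono mult_right_mono mult_nonneg_nonneg)
      (auto simp: EF_def field_simps)
  finally show "(\<integral>x. f (W' x) \<partial>M) + a / 2 * (\<integral>x. (norm (F (W x)))\<^sup>2 \<partial>M)
      \<le> (\<integral>x. f (W x) \<partial>M) + L * V / 2 * a\<^sup>2"
    by (simp add: EF_def)
  have "(\<integral>x. (norm (F (W' x)))\<^sup>2 \<partial>M)
      \<le> (\<integral>x. (norm (F (W x)))\<^sup>2 + L * a * ((norm (F (W x)))\<^sup>2 + 2 * (norm (G x))\<^sup>2) \<partial>M)"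
  proof (rule integral_mono_AE)
    show "AE x in M. (norm (F (W' x)))\<^sup>2
        \<le> (norm (F (W x)))\<^sup>2 + L * a * ((norm (F (W x)))\<^sup>2 + 2 * (norm (G x))\<^sup>2)"
      using upd by eventually_elim (simp add: gradient_step_norm_sq_le[OF a])
  qed (use integrable_gradient_norm_sq[OF W' int_f'] sq_F sq_G in simp_all)
  also have "\<dots> = EF + L * a * (EF + 2 * EG)"
    using sq_F sq_G by (simp add: EF_def EG_def)
  also have "\<dots> \<le> EF + L * a * (EF + 2 * (EF + V))"
    using EG L_pos a by (intro add_left_mono mult_left_mono) auto
  finally show "(\<integral>x. (norm (F (W' x)))\<^sup>2 \<partial>M)
      \<le> (\<integral>x. (norm (F (W x)))\<^sup>2 \<partial>M) + L * a * (3 * (\<integral>x. (norm (F (W x)))\<^sup>2 \<partial>M) + 2 * V)"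
    by (simp add: EF_def algebra_simps)
qed

section \<open>Convergence in probability for coercive functions\<close>

text \<open>A point farther than \<open>\<delta>\<close> from the zeros of \<open>F\<close> either
  has \<open>f\<close> at least \<open>R\<close> or lies in a compact set on which \<open>F\<close>
  is bounded away from 0. Markov's inequality bounds both events: \<open>R\<close> makes the first
  unlikely uniformly in \<open>n\<close>, then large \<open>n\<close> handles the second.\<close>

lemma coercive_imp_close_to_zeros:
  fixes f :: "'b::euclidean_space \<Rightarrow> real" and F :: "'b \<Rightarrow> 'b" and W :: "nat \<Rightarrow> 'a \<Rightarrow> 'b"
  assumes "prob_space M" and f: "continuous_on UNIV f" and F: "continuous_on UNIV F"
    and nonneg: "\<And>v. f v \<ge> 0"
    and coercive: "filterlim (\<lambda>v. \<bar>f v\<bar>) at_top at_infinity"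
    and W [measurable]: "\<And>n. W n \<in> borel_measurable M"
    and int_f: "\<And>n. integrable M (\<lambda>x. f (W n x))" and bound: "\<And>n. (\<integral>x. f (W n x) \<partial>M) \<le> A"
    and int_F: "\<And>n. integrable M (\<lambda>x. (norm (F (W n x)))\<^sup>2)"
    and lim: "(\<lambda>n. \<integral>x. (norm (F (W n x)))\<^sup>2 \<partial>M) \<longlonglongrightarrow> 0"
    and "\<delta> > 0"
  shows "(\<lambda>n. measure M {x \<in> space M. infdist (W n x) {v. F v = 0} > \<delta>}) \<longlonglongrightarrow> 0"
proof (rule LIMSEQ_I)
  fix r :: real
  assume "r > 0"
  interpret prob_space M by fact
  have [measurable]: "f \<in> borel_measurable borel" "F \<in> borel_measurable borel"
    using f F by (auto intro: borel_measurable_continuous_onI)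
  have A: "A \<ge> 0"
  proof -
    have "0 \<le> (\<integral>x. f (W 0 x) \<partial>M)"
      using nonneg by simp
    with bound[of 0] show ?thesis
      by linarith
  qed
  \<comment> \<open>Chosen so that \<open>A / R\<close> is at most \<open>r / 2\<close>; the summand
    1 keeps \<open>R\<close> positive when \<open>A = 0\<close>.\<close>
  define R where "R = 2 * (A + 1) / r"
  have R: "R > 0"
    using \<open>r > 0\<close> A by (simp add: R_def)
  define K where "K = {v. f v \<le> R \<and> infdist v {v. F v = 0} \<ge> \<delta>}"
  have "compact K"
  proof -
    \<comment> \<open>The level \<open>R + 1\<close> lies strictly above \<open>R\<close>, so the
      sublevel set at \<open>R\<close> is contained in a ball.\<close>
    have "\<forall>\<^sub>F v in at_infinity. R + 1 \<le> \<bar>f v\<bar>"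
      using coercive by (simp add: filterlim_at_top)
    then obtain b where "\<And>v. norm v \<ge> b \<Longrightarrow> R + 1 \<le> \<bar>f v\<bar>"
      by (auto simp: eventually_at_infinity)
    then have "norm v \<le> b" if "f v \<le> R" for v
      using that nonneg[of v] by (smt (verit))
    then have "bounded K"
      by (auto simp: K_def bounded_iff)
    moreover have "closed K"
      unfolding K_def using f by (intro closed_Collect_conj closed_Collect_le continuous_intros)
    ultimately show ?thesis
      by (simp add: compact_eq_bounded_closed)
  qed
  obtain c where c: "c > 0" "\<And>v. v \<in> K \<Longrightarrow> c \<le> (norm (F v))\<^sup>2"
  proof (cases "K = {}")
    case True
    then show ?thesis
      using that[of 1] by simp
  next
    case False
    have "continuous_on K (\<lambda>v. (norm (F v))\<^sup>2)"
      using F by (intro continuous_intros) (rule continuous_on_subset, auto)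
    then obtain u where u: "u \<in> K" "\<And>v. v \<in> K \<Longrightarrow> (norm (F u))\<^sup>2 \<le> (norm (F v))\<^sup>2"
      using continuous_attains_inf[OF \<open>compact K\<close> False] by blast
    \<comment> \<open>A zero of \<open>F\<close> has \<open>infdist\<close> 0 to the zero set,
      whereas points of \<open>K\<close> have at least \<open>\<delta>\<close>.\<close>
    have "F u \<noteq> 0"
      using u(1) \<open>\<delta> > 0\<close> by (auto simp: K_def)
    then show ?thesis
      using that[of "(norm (F u))\<^sup>2"] u by simp
  qed
  \<comment> \<open>Markov's inequality at level \<open>c\<close> divides by \<open>c\<close>,
    leaving \<open>r / 2\<close>.\<close>
  obtain n0 where n0: "\<And>n. n \<ge> n0 \<Longrightarrow> (\<integral>x. (norm (F (W n x)))\<^sup>2 \<partial>M) < c * (r / 2)"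
    using LIMSEQ_D[OF lim, of "c * (r / 2)"] \<open>r > 0\<close> c(1) by fastforce
  show "\<exists>n0. \<forall>n\<ge>n0. norm (measure M {x \<in> space M. infdist (W n x) {v. F v = 0} > \<delta>} - 0) < r"
  proof (intro exI allI impI)
    fix n assume "n \<ge> n0"
    have "measure M {x \<in> space M. infdist (W n x) {v. F v = 0} > \<delta>}
      \<le> measure M ({x \<in> space M. R \<le> f (W n x)} \<union> {x \<in> space M. c \<le> (norm (F (W n x)))\<^sup>2})"
    proof (rule finite_measure_mono)
      have "R \<le> f v \<or> c \<le> (norm (F v))\<^sup>2" if "infdist v {v. F v = 0} > \<delta>" for v
        using c(2)[of v] that linear[of R "f v"] by (auto simp: K_def)
      then show "{x \<in> space M. infdist (W n x) {v. F v = 0} > \<delta>}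
          \<subseteq> {x \<in> space M. R \<le> f (W n x)} \<union> {x \<in> space M. c \<le> (norm (F (W n x)))\<^sup>2}"
        by blast
    qed measurable
    also have "\<dots> \<le> measure M {x \<in> space M. R \<le> f (W n x)}
        + measure M {x \<in> space M. c \<le> (norm (F (W n x)))\<^sup>2}"
      by (intro measure_Un_le) measurable
    also have "\<dots> \<le> (\<integral>x. f (W n x) \<partial>M) / R + (\<integral>x. (norm (F (W n x)))\<^sup>2 \<partial>M) / c"
      using R c(1) nonneg
      by (intro add_mono integral_Markov_inequality_measure[where A = "{}"] int_f int_F) auto
    also have "\<dots> < A / R + r / 2"
      using bound[of n] n0[OF \<open>n \<ge> n0\<close>] R c(1)
      by (intro add_le_less_mono divide_right_mono) (auto simp: field_simps)
    also have "\<dots> \<le> r"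
      using A \<open>r > 0\<close> by (simp add: R_def field_simps)
    finally show "norm (measure M {x \<in> space M. infdist (W n x) {v. F v = 0} > \<delta>} - 0) < r"
      by simp
  qed
qed

section \<open>Assembly of the three convergence statements\<close>

theorem theorem1p6:
  fixes L \<sigma> :: real
  assumes "L > 0" and "\<sigma> \<ge> 0"
  shows "sgd_alpha0 L > 0 \<and>
    (\<forall>(f :: real ^ 'n \<Rightarrow> real) (\<alpha> :: nat \<Rightarrow> real) (M :: 'a measure)
        (w :: nat \<Rightarrow> 'a \<Rightarrow> real ^ 'n) (g :: nat \<Rightarrow> 'a \<Rightarrow> real ^ 'n).
       (\<forall>v. f v \<ge> 0) \<and> C2 f \<and> (\<forall>v. matrix_opnorm (hessian f v) \<le> L) \<and>
       antimono_on {1..} \<alpha> \<and> (\<forall>m\<ge>1. 0 \<le> \<alpha> m \<and> \<alpha> m \<le> sgd_alpha0 L) \<and>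
       filterlim (\<lambda>n. \<Sum>m=1..n. \<alpha> m) at_top sequentially \<and>
       summable (\<lambda>m. (\<alpha> (Suc m))\<^sup>2) \<and>
       prob_space M \<and> sgd M f \<alpha> w g \<and> sgd_variance_bound M f w g \<sigma> \<and>
       expect_nn M (\<lambda>x. f (w 1 x)) < \<infinity>
       \<longrightarrow>
       ((\<lambda>m. expect_nn M (\<lambda>x. f (w m x)))
           \<longlonglongrightarrow> liminf (\<lambda>k. expect_nn M (\<lambda>x. f (w k x))) \<and>
         liminf (\<lambda>k. expect_nn M (\<lambda>x. f (w k x))) < \<infinity>) \<and>
       (\<lambda>m. expect_nn M (\<lambda>x. (norm (grad f (w m x)))\<^sup>2)) \<longlonglongrightarrow> 0 \<and>
       (filterlim (\<lambda>v. \<bar>f v\<bar>) at_top at_infinity \<longrightarrow>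
         (\<forall>\<delta>>0. (\<lambda>m. measure M {x \<in> space M. infdist (w m x) (critical_points f) > \<delta>})
            \<longlonglongrightarrow> 0)))"
proof (intro conjI allI impI)
  show "sgd_alpha0 L > 0"
    using assms by (simp add: sgd_alpha0_def)
next
  fix f :: "real ^ 'n \<Rightarrow> real" and \<alpha> :: "nat \<Rightarrow> real" and M :: "'a measure"
    and w g :: "nat \<Rightarrow> 'a \<Rightarrow> real ^ 'n"
  assume "(\<forall>v. f v \<ge> 0) \<and> C2 f \<and> (\<forall>v. matrix_opnorm (hessian f v) \<le> L) \<and>
       antimono_on {1..} \<alpha> \<and> (\<forall>m\<ge>1. 0 \<le> \<alpha> m \<and> \<alpha> m \<le> sgd_alpha0 L) \<and>
       filterlim (\<lambda>n. \<Sum>m=1..n. \<alpha> m) at_top sequentially \<and>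
       summable (\<lambda>m. (\<alpha> (Suc m))\<^sup>2) \<and>
       prob_space M \<and> sgd M f \<alpha> w g \<and> sgd_variance_bound M f w g \<sigma> \<and>
       expect_nn M (\<lambda>x. f (w 1 x)) < \<infinity>"
  then have nonneg: "\<And>v. f v \<ge> 0" and C2: "C2 f" and hess: "\<And>v. matrix_opnorm (hessian f v) \<le> L"
    and \<alpha>: "\<And>n. 0 \<le> \<alpha> (Suc n)" "\<And>n. \<alpha> (Suc n) \<le> 1 / L"
    and div: "filterlim (\<lambda>n. \<Sum>m=1..n. \<alpha> m) at_top sequentially"
    and sq_sum: "summable (\<lambda>m. (\<alpha> (Suc m))\<^sup>2)"
    and "prob_space M" and sgd: "sgd M f \<alpha> w g" and var: "sgd_variance_bound M f w g \<sigma>"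
    and init: "expect_nn M (\<lambda>x. f (w 1 x)) < \<infinity>"
    by (simp_all add: sgd_alpha0_def)
  interpret prob_space M by fact
  interpret lipschitz_gradient f "grad f" L
    using assms nonneg C2_gderiv[OF C2] C2_grad_lipschitz[OF C2 hess] by unfold_locales
  have [measurable]: "f \<in> borel_measurable borel" "grad f \<in> borel_measurable borel"
    using continuous_on_f continuous_on_F by (auto intro: borel_measurable_continuous_onI)
  have w [measurable]: "w (Suc n) \<in> borel_measurable M" for n
    using sgd by (simp add: sgd_def)
  \<comment> \<open>The index is shifted by one because the values at index 0 are
    unconstrained.\<close>
  define A where "A n = (\<integral>x. f (w (Suc n) x) \<partial>M)" for n
  define G where "G n = (\<integral>x. (norm (grad f (w (Suc n) x)))\<^sup>2 \<partial>M)" for n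
  let ?a = "\<lambda>n. \<alpha> (Suc n)"
  have G_nonneg: "G n \<ge> 0" and A_nonneg: "A n \<ge> 0" for n
    using nonneg by (auto simp: G_def A_def)
  have step: "integrable M (\<lambda>x. f (w (Suc (Suc n)) x))"
      "A (Suc n) + ?a n / 2 * G n \<le> A n + L * \<sigma>\<^sup>2 / 2 * (?a n)\<^sup>2"
      "G (Suc n) \<le> G n + L * ?a n * (3 * G n + 2 * \<sigma>\<^sup>2)"
    if "integrable M (\<lambda>x. f (w (Suc n) x))" for n
    using sgd_expectation_step[OF lipschitz_gradient_axioms \<open>prob_space M\<close> w w _ _ _ \<alpha>(1)[of n] \<alpha>(2)[of n] _ that,
        where G = "g (Suc n)" and V = "\<sigma>\<^sup>2"] sgd var
    by (simp_all add: sgd_def sgd_variance_bound_def A_def G_def)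
  \<comment> \<open>Finiteness propagates from the initial expectation along the steps, so every
    \<open>A n\<close> is a genuine expectation and not the default value 0 of a missing
    integral.\<close>
  have int_f: "integrable M (\<lambda>x. f (w (Suc n) x))" for n
  proof (induction n)
    case 0
    show ?case
      using init nonneg by (intro integrableI_nonneg) (simp_all add: expect_nn_def)
  next
    case (Suc n)
    then show ?case by (rule step)
  qed
  note int_F = integrable_gradient_norm_sq[OF w int_f]
  have "summable (\<lambda>n. L * \<sigma>\<^sup>2 / 2 * (?a n)\<^sup>2)"
    using sq_sum by (rule summable_mult)
  then have conv: "convergent A" and sum: "summable (\<lambda>n. ?a n / 2 * G n)"
    using almost_decreasing_convergent[of A "\<lambda>n. ?a n / 2 * G n" "\<lambda>n. L * \<sigma>\<^sup>2 / 2 * (?a n)\<^sup>2"]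
      A_nonneg G_nonneg \<alpha> step(2)[OF int_f] by auto
  obtain l where l: "A \<longlonglongrightarrow> l"
    using conv by (auto simp: convergent_def)
  \<comment> \<open>This uniform bound enters the growth constant of \<open>G\<close> and later the
    Markov estimate for \<open>f\<close>.\<close>
  obtain B where B: "\<And>n. A n \<le> B"
    using convergent_imp_Bseq[OF conv] by (auto simp: Bseq_def abs_le_iff)
  have G_lim: "G \<longlonglongrightarrow> 0"
  proof (rule weighted_summable_imp_tendsto_zero)
    show "G n \<ge> 0" "?a n \<ge> 0" for n
      by (fact G_nonneg, fact \<alpha>)
    show "?a \<longlonglongrightarrow> 0"
      using summable_LIMSEQ_zero[OF sq_sum] tendsto_power_strong by simp
    show "\<not> summable ?a"
    proof
      assume "summable ?a"
      then have "(\<lambda>n. \<Sum>m=1..n. \<alpha> m) \<longlonglongrightarrow> suminf ?a"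
        using summable_LIMSEQ by (simp add: sum.atLeast1_atMost_eq)
      with div show False
        using not_tendsto_and_filterlim_at_infinity[OF sequentially_bot]
          filterlim_at_top_imp_at_infinity by blast
    qed
    show "summable (\<lambda>n. ?a n * G n)"
      using summable_mult[OF sum, of 2] by simp
    \<comment> \<open>The growth constant comes from inserting
      \<open>G n \<le> 2 * L * A n \<le> 2 * L * B\<close> into the third step estimate.\<close>
    have B0: "B \<ge> 0"
      using A_nonneg B order_trans by blast
    then show "0 \<le> L * (6 * L * B + 2 * \<sigma>\<^sup>2)"
      using L_pos by simp
    fix n
    have "G n \<le> (\<integral>x. 2 * L * f (w (Suc n) x) \<partial>M)"
      unfolding G_def using int_F int_f gradient_norm_sq_le by (intro integral_mono) auto
    also have "\<dots> = 2 * L * A n"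
      by (simp add: A_def)
    also have "\<dots> \<le> 2 * L * B"
      using B L_pos by simp
    finally have "L * ?a n * (3 * G n + 2 * \<sigma>\<^sup>2) \<le> L * ?a n * (3 * (2 * L * B) + 2 * \<sigma>\<^sup>2)"
      using L_pos \<alpha> by (intro mult_left_mono add_right_mono) auto
    then show "G (Suc n) \<le> G n + L * (6 * L * B + 2 * \<sigma>\<^sup>2) * ?a n"
      using step(3)[OF int_f, of n] by (simp add: algebra_simps)
  qed
  have expect_A: "expect_nn M (\<lambda>x. f (w (Suc n) x)) = ennreal (A n)" for n
    using int_f nonneg by (simp add: expect_nn_def A_def nn_integral_eq_integral)
  have expect_G: "expect_nn M (\<lambda>x. (norm (grad f (w (Suc n) x)))\<^sup>2) = ennreal (G n)" for n
    using int_F by (simp add: expect_nn_def G_def nn_integral_eq_integral)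
  \<comment> \<open>Passing to the shifted sequence discards index 0. The limit is the image of a
    real number, hence the limit inferior is finite.\<close>
  have lim_f: "(\<lambda>m. expect_nn M (\<lambda>x. f (w m x))) \<longlonglongrightarrow> ennreal l"
    by (subst filterlim_sequentially_Suc[symmetric]) (simp add: expect_A l tendsto_ennrealI)
  then have liminf_f: "liminf (\<lambda>m. expect_nn M (\<lambda>x. f (w m x))) = ennreal l"
    by (intro lim_imp_Liminf) auto
  show "(\<lambda>m. expect_nn M (\<lambda>x. f (w m x))) \<longlonglongrightarrow> liminf (\<lambda>k. expect_nn M (\<lambda>x. f (w k x)))"
    unfolding liminf_f by (rule lim_f)
  show "liminf (\<lambda>k. expect_nn M (\<lambda>x. f (w k x))) < \<infinity>"
    unfolding liminf_f by simp
  show "(\<lambda>m. expect_nn M (\<lambda>x. (norm (grad f (w m x)))\<^sup>2)) \<longlonglongrightarrow> 0"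
    using tendsto_ennrealI[OF G_lim]
    by (subst filterlim_sequentially_Suc[symmetric]) (simp add: expect_G)
  fix \<delta> :: real
  assume coercive: "filterlim (\<lambda>v. \<bar>f v\<bar>) at_top at_infinity" and "\<delta> > 0"
  have "(\<lambda>n. measure M {x \<in> space M. infdist (w (Suc n) x) {v. grad f v = 0} > \<delta>}) \<longlonglongrightarrow> 0"
    using coercive_imp_close_to_zeros[OF \<open>prob_space M\<close> continuous_on_f continuous_on_F nonneg
        coercive w int_f _ int_F G_lim[unfolded G_def] \<open>\<delta> > 0\<close>, of B] B by (simp add: A_def)
  then show "(\<lambda>m. measure M {x \<in> space M. infdist (w m x) (critical_points f) > \<delta>}) \<longlonglongrightarrow> 0"
    unfolding critical_points_def by (subst filterlim_sequentially_Suc[symmetric])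
qed

end
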